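(* Let $(X,\tau,\mathfrak{M},\mu)$ be a topological measure space with the property that there exists a collection $\{O_j\}_{j=1}^\infty$ of open sets satisfying $X=\bigcup_{j=1}^\infty O_j$ and $\mu(O_j)<\infty$ for all $j\in\mathbb{N}$. Suppose further that every open set $U\subseteq X$ can be written as $U=F\cup Z$, where $F$ is an $F_\sigma$ set and $Z$ is a null set. Then the following statements (1)-(4) are equivalent. (1) The measure $\mu$ is Borel regular. (2) Each measurable function has a Borel representative, i.e., for every measurable function $u:X\to\overline{\mathbb{R}}$, there exist a Borel set $N\subseteq X$ and a Borel function $f:X\to\overline{\mathbb{R}}$ such that $\mu(N)=0$ and $f=u$ pointwise in $X\setminus N$. (3) The weak Lusin theorem holds, i.e., for every measurable function $u:X\to\overline{\mathbb{R}}$ and any $\varepsilon\in(0,\infty)$, there exists a closed set $C_\varepsilon\subseteq X$ such that $\mu(X\setminus C_\varepsilon)<\varepsilon$ and the restriction of $u$ to $C_\varepsilon$ is continuous with respect to the subspace topology $\tau|_{C_\varepsilon}$. (4) For every measurable function $u:X\to\overline{\mathbb{R}}$ and any $\varepsilon\in(0,\infty)$, there exists a Borel set $B_\varepsilon\subseteq X$ such that $\mu(X\setminus B_\varepsilon)<\varepsilon$ and the restriction of $u$ to $B_\varepsilon$ is continuous (with respect to the subspace topology). If, in addition, $(X,\tau)$ is assumed to be normal, then each of the statements (1)-(4) is further equivalent to each of the following statements. (5) The strong Lusin theorem holds, i.e., for every measurable function $u:X\to\overline{\mathbb{R}}$ and any $\varepsilon\in(0,\infty)$, there exist a closed set $C_\varepsilon\subseteq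 X$ and a continuous function $g:X\to\overline{\mathbb{R}}$ such that $\mu(X\setminus C_\varepsilon)<\varepsilon$ and $g=u$ pointwise in $C_\varepsilon$. (6) For every measurable function $u:X\to\overline{\mathbb{R}}$ and any $\varepsilon\in(0,\infty)$, there exist a Borel set $B_\varepsilon\subseteq X$ and a continuous function $g:X\to\overline{\mathbb{R}}$ such that $\mu(X\setminus B_\varepsilon)<\varepsilon$ and $g=u$ pointwise in $B_\varepsilon$.
   Context: $\overline{\mathbb{R}}:=[-\infty,\infty]$ with its usual topology. A topological measure space is a quadruple $(X,\tau,\mathfrak{M},\mu)$ where $(X,\tau)$ is a topological space, $\mathfrak{M}$ is a $\sigma$-algebra of subsets of $X$ containing the Borel $\sigma$-algebra $\mathrm{Borel}_\tau(X)$ (equality is not required), and $\mu:\mathfrak{M}\to[0,\infty]$ is a nonnegative measure. Measurable means with respect to $\mathfrak{M}$; Borel sets and functions are with respect to $\mathrm{Borel}_\tau(X)$. The measure $\mu$ is Borel regular if for every $E\in\mathfrak{M}$ there exists $B\in\mathrm{Borel}_\tau(X)$ with $E\subseteq B$ and $\mu(B)=\mu(E)$. A null set is a set $Z\in\mathfrak{M}$ with $\mu(Z)=0$; an $F_\sigma$ set is a countable union of closed sets. $(X,\tau)$ is normal if any two disjoint closed sets $A,B\subseteq X$ are contained in disjoint open sets $U\supseteq A$, $V\supseteq B$ (no separation axiom on points is assumed). *)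

theory Defs
  imports "HOL-Analysis.Analysis"
begin

text \<open>
  The extended real line is \<^typ>\<open>ereal\<close>, whose type class topology is the usual one of the
  interval from minus infinity to infinity. Functions on the space are total functions on the type
  \<^typ>\<open>'a\<close>; all conditions below only involve their values on \<^term>\<open>topspace T\<close>.
\<close>

definition Borel_of :: "'a topology \<Rightarrow> 'a measure" where
  "Borel_of T = sigma (topspace T) {U. openin T U}"

text \<open>The sigma-algebra of \<open>M\<close> may be strictly larger than the Borel sigma-algebra.\<close>

definition topological_measure_space :: "'a topology \<Rightarrow> 'a measure \<Rightarrow> bool" where
  "topological_measure_space T M \<longleftrightarrow>
     space M = topspace T \<and> sets (Borel_of T) \<subseteq> sets M"

definition Borel_regular :: "'a topology \<Rightarrow> 'a measure \<Rightarrow> bool" where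
  "Borel_regular T M \<longleftrightarrow>
     (\<forall>E\<in>sets M. \<exists>B\<in>sets (Borel_of T). E \<subseteq> B \<and> emeasure M B = emeasure M E)"

definition Borel_representatives :: "'a topology \<Rightarrow> 'a measure \<Rightarrow> bool" where
  "Borel_representatives T M \<longleftrightarrow>
     (\<forall>u :: 'a \<Rightarrow> ereal. u \<in> borel_measurable M \<longrightarrow>
        (\<exists>N\<in>sets (Borel_of T). \<exists>f :: 'a \<Rightarrow> ereal. f \<in> borel_measurable (Borel_of T) \<and>
           emeasure M N = 0 \<and> (\<forall>x\<in>topspace T - N. f x = u x)))"

definition weak_Lusin :: "'a topology \<Rightarrow> 'a measure \<Rightarrow> bool" where
  "weak_Lusin T M \<longleftrightarrow>
     (\<forall>(u :: 'a \<Rightarrow> ereal) (\<epsilon> :: real). u \<in> borel_measurable M \<and> 0 < \<epsilon> \<longrightarrow>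
        (\<exists>C. closedin T C \<and> emeasure M (topspace T - C) < ennreal \<epsilon> \<and>
           continuous_map (subtopology T C) euclidean u))"

definition weak_Lusin_Borel :: "'a topology \<Rightarrow> 'a measure \<Rightarrow> bool" where
  "weak_Lusin_Borel T M \<longleftrightarrow>
     (\<forall>(u :: 'a \<Rightarrow> ereal) (\<epsilon> :: real). u \<in> borel_measurable M \<and> 0 < \<epsilon> \<longrightarrow>
        (\<exists>B\<in>sets (Borel_of T). emeasure M (topspace T - B) < ennreal \<epsilon> \<and>
           continuous_map (subtopology T B) euclidean u))"

definition strong_Lusin :: "'a topology \<Rightarrow> 'a measure \<Rightarrow> bool" where
  "strong_Lusin T M \<longleftrightarrow>
     (\<forall>(u :: 'a \<Rightarrow> ereal) (\<epsilon> :: real). u \<in> borel_measurable M \<and> 0 < \<epsilon> \<longrightarrow>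
        (\<exists>C. \<exists>g :: 'a \<Rightarrow> ereal. closedin T C \<and> continuous_map T euclidean g \<and>
           emeasure M (topspace T - C) < ennreal \<epsilon> \<and> (\<forall>x\<in>C. g x = u x)))"

definition strong_Lusin_Borel :: "'a topology \<Rightarrow> 'a measure \<Rightarrow> bool" where
  "strong_Lusin_Borel T M \<longleftrightarrow>
     (\<forall>(u :: 'a \<Rightarrow> ereal) (\<epsilon> :: real). u \<in> borel_measurable M \<and> 0 < \<epsilon> \<longrightarrow>
        (\<exists>B\<in>sets (Borel_of T). \<exists>g :: 'a \<Rightarrow> ereal. continuous_map T euclidean g \<and>
           emeasure M (topspace T - B) < ennreal \<epsilon> \<and> (\<forall>x\<in>B. g x = u x)))"

end

theory Submission
  imports Defs
begin

text \<open>
  Everything rests on one regularity property: under Borel regularity a measurable set \<open>E\<close> can be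
  squeezed between a closed set \<open>C\<close> and an open set \<open>U\<close> with \<open>U - C\<close> of arbitrarily small measure
  (\<open>measurable_squeeze\<close>). Inside a fixed set \<open>D\<close> of finite measure, the Borel sets that can be squeezed
  form a \<open>\<sigma>\<close>-algebra, and the hypothesis on open sets puts the open sets into it:
  an open set is up to a null set an increasing union of closed sets, and finiteness of the measure
  of \<open>D\<close> makes one of these closed sets a good inner approximation. For outer approximation the
  restriction to \<open>D\<close> is removed by intersecting with the \<^emph>\<open>open\<close> sets of finite measure that cover
  the space and adding up the errors; inner approximation follows by taking complements; and Borel
  regularity passes from Borel to measurable sets, because a measurable set has a Borel hull whose
  excess is null.

  The weak Lusin theorem follows without any reduction to simple functions. If \<open>W\<^sub>n\<close> is a countable
  base of the target and the preimage of \<open>W\<^sub>n\<close> under \<open>u\<close> is squeezed between \<open>C\<^sub>n\<close> and \<open>U\<^sub>n\<close>, then on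
  the closed complement of the union of all \<open>U\<^sub>n - C\<^sub>n\<close> that preimage coincides with the open set
  \<open>U\<^sub>n\<close>, so \<open>u\<close> is continuous there.

  The way back runs through the Borel version of Lusin's theorem. A function that is continuous on
  Borel sets \<open>B\<^sub>n\<close> whose union has null complement agrees with a Borel function on that union, so it
  has a Borel representative; and a Borel representative of the indicator function of \<open>E\<close> yields a
  Borel hull of \<open>E\<close>.

  In a normal space the weak theorem becomes the strong one by Tietze's extension theorem, applied
  to extended real functions through the order isomorphism of \<open>[-\<pi>/2, \<pi>/2]\<close> with the extended
  real line that is \<open>tan\<close> in the interior. The strong theorem trivially implies its
  Borel version, and that one, by restricting the continuous function, the weak Borel version.
\<close>

section \<open>Borel sets of an abstract topology\<close>

lemma space_Borel_of [simp]: "space (Borel_of T) = topspace T"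
  and sets_Borel_of: "sets (Borel_of T) = sigma_sets (topspace T) {U. openin T U}"
proof -
  have "{U. openin T U} \<subseteq> Pow (topspace T)"
    by (auto dest: openin_subset)
  then show "space (Borel_of T) = topspace T"
    and "sets (Borel_of T) = sigma_sets (topspace T) {U. openin T U}"
    by (simp_all add: Borel_of_def)
qed

lemma openin_Borel_of: "openin T U \<Longrightarrow> U \<in> sets (Borel_of T)"
  by (simp add: sets_Borel_of sigma_sets.Basic)

lemma closedin_Borel_of:
  assumes "closedin T C"
  shows "C \<in> sets (Borel_of T)"
proof -
  have "space (Borel_of T) - (topspace T - C) \<in> sets (Borel_of T)"
    using assms by (intro sets.compl_sets openin_Borel_of) (simp add: closedin_def)
  moreover have "topspace T - (topspace T - C) = C"
    using closedin_subset[OF assms] by blast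
  ultimately show ?thesis
    by simp
qed

lemma topological_measure_spaceD:
  assumes "topological_measure_space T M"
  shows "space M = topspace T"
    and "B \<in> sets (Borel_of T) \<Longrightarrow> B \<in> sets M"
    and "openin T U \<Longrightarrow> U \<in> sets M"
    and "closedin T C \<Longrightarrow> C \<in> sets M"
  using assms openin_Borel_of closedin_Borel_of
  unfolding topological_measure_space_def by blast+

lemma emeasure_UN_geometric_le:
  fixes \<epsilon> :: real
  assumes "\<And>n. A n \<in> sets M" "\<And>n. emeasure M (A n) \<le> ennreal (\<epsilon> * (1/2) ^ Suc n)" "0 < \<epsilon>"
  shows "emeasure M (\<Union>n. A n) \<le> ennreal \<epsilon>"
proof -
  have "(\<lambda>n. \<epsilon> * (1/2) ^ Suc n) sums \<epsilon>"
    using sums_mult[OF power_half_series, of \<epsilon>] by simp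
  then have "(\<Sum>n. ennreal (\<epsilon> * (1/2) ^ Suc n)) = ennreal \<epsilon>"
    using \<open>0 < \<epsilon>\<close> by (intro suminf_ennreal_eq) auto
  moreover have "emeasure M (\<Union>n. A n) \<le> (\<Sum>n. emeasure M (A n))"
    using assms(1) by (intro emeasure_subadditive_countably) auto
  moreover have "(\<Sum>n. emeasure M (A n)) \<le> (\<Sum>n. ennreal (\<epsilon> * (1/2) ^ Suc n))"
    using assms(2) by (intro suminf_le) auto
  ultimately show ?thesis
    by simp
qed

section \<open>Approximation by closed and open sets\<close>

text \<open>
  Continuity from above along an increasing exhaustion by closed sets; finiteness of the measure
  of \<open>D\<close> is what makes this work.
\<close>

lemma fsigma_closed_inner_approx:
  assumes tms: "topological_measure_space T M"
    and D: "D \<in> sets M" "emeasure M D < \<infinity>"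
    and "fsigma_in T F" "0 < (\<epsilon> :: ennreal)"
  obtains C where "closedin T C" "C \<subseteq> F" "emeasure M (D \<inter> (F - C)) < \<epsilon>"
proof -
  obtain K where K: "\<And>n. closedin T (K n)" "\<And>n. K n \<subseteq> K (Suc n)" "\<Union> (range K) = F"
    using \<open>fsigma_in T F\<close> by (auto simp: fsigma_in_ascending)
  have KM: "K n \<in> sets M" for n
    using K(1) topological_measure_spaceD[OF tms] by blast
  have FM: "F \<in> sets M"
    using KM K(3) by (metis sets.countable_UN image_subsetI)
  let ?A = "\<lambda>n. D \<inter> (F - K n)"
  have "(\<lambda>n. emeasure M (?A n)) \<longlonglongrightarrow> emeasure M (\<Inter>n. ?A n)"
  proof (rule Lim_emeasure_decseq)
    show "range ?A \<subseteq> sets M"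
      using KM FM D by auto
    show "decseq ?A"
      using K(2) by (intro decseq_SucI) blast
    show "emeasure M (?A i) \<noteq> \<infinity>" for i
    proof -
      have "emeasure M (?A i) \<le> emeasure M D"
        using D by (intro emeasure_mono) auto
      then show ?thesis
        using D(2) by (auto simp: top_unique)
    qed
  qed
  moreover have "(\<Inter>n. ?A n) = {}"
    using K(3) by blast
  ultimately have "(\<lambda>n. emeasure M (?A n)) \<longlonglongrightarrow> 0"
    by simp
  then have "eventually (\<lambda>n. emeasure M (?A n) < \<epsilon>) sequentially"
    using \<open>0 < \<epsilon>\<close> by (rule order_tendstoD)
  then obtain n where "emeasure M (?A n) < \<epsilon>"
    by (auto simp: eventually_sequentially)
  with K show thesis
    by (intro that[of "K n"]) auto
qed

text \<open>
  The sets that can be squeezed inside \<open>D\<close> form a \<open>\<sigma>\<close>-algebra. Complements exchange the closed and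
  the open set. For a countable union the closed sets only give an \<open>F\<^sub>\<sigma>\<close> set, which is then thinned
  out to a closed one at the cost of a second \<open>\<epsilon>/2\<close>.
\<close>

lemma Borel_squeeze_finite:
  fixes \<epsilon> :: real
  assumes tms: "topological_measure_space T M"
    and ofs: "\<And>U. openin T U \<Longrightarrow> \<exists>F Z. fsigma_in T F \<and> Z \<in> null_sets M \<and> U = F \<union> Z"
    and D: "D \<in> sets M" "emeasure M D < \<infinity>"
    and E: "E \<in> sets (Borel_of T)" and "0 < \<epsilon>"
  shows "\<exists>C U. closedin T C \<and> openin T U \<and> C \<subseteq> E \<and> E \<subseteq> U \<and> emeasure M (D \<inter> (U - C)) \<le> ennreal \<epsilon>"
  using E[unfolded sets_Borel_of] \<open>0 < \<epsilon>\<close>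
proof (induction E arbitrary: \<epsilon> rule: sigma_sets.induct)
  case (Basic U \<epsilon>)
  then have U: "openin T U"
    by simp
  then obtain F Z where FZ: "fsigma_in T F" "Z \<in> null_sets M" "U = F \<union> Z"
    using ofs by blast
  obtain C where C: "closedin T C" "C \<subseteq> F" "emeasure M (D \<inter> (F - C)) < ennreal \<epsilon>"
    using fsigma_closed_inner_approx[OF tms D FZ(1), of "ennreal \<epsilon>"] Basic by auto
  have sets: "U \<in> sets M" "C \<in> sets M" "Z \<in> sets M"
    using U C FZ(2) topological_measure_spaceD[OF tms] by auto
  have "F \<in> sets M"
    using FZ(1) topological_measure_spaceD(4)[OF tms]
    by (auto simp: fsigma_in_def union_of_def intro!: sets.countable_Union)
  then have "emeasure M (D \<inter> (U - C)) \<le> emeasure M ((D \<inter> (F - C)) \<union> Z)"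
    using FZ(3) D sets by (intro emeasure_mono) auto
  also have "\<dots> = emeasure M (D \<inter> (F - C))"
    using D sets \<open>F \<in> sets M\<close> FZ(2) by (intro emeasure_Un_null_set) auto
  finally show ?case
    using C U FZ(3) by (intro exI[of _ C] exI[of _ U]) auto
next
  case (Empty \<epsilon>)
  show ?case
    by (intro exI[of _ "{}"]) auto
next
  case (Compl E \<epsilon>)
  obtain C U where CU: "closedin T C" "openin T U" "C \<subseteq> E" "E \<subseteq> U"
      "emeasure M (D \<inter> (U - C)) \<le> ennreal \<epsilon>"
    using Compl.IH[OF Compl.prems] by blast
  have "(topspace T - C) - (topspace T - U) = U - C"
    using openin_subset[OF CU(2)] by blast
  then show ?case
    using CU by (intro exI[of _ "topspace T - U"] exI[of _ "topspace T - C"]) auto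
next
  case (Union E \<epsilon>)
  have "\<exists>C U. closedin T C \<and> openin T U \<and> C \<subseteq> E n \<and> E n \<subseteq> U \<and>
      emeasure M (D \<inter> (U - C)) \<le> ennreal (\<epsilon>/2 * (1/2) ^ Suc n)" for n
    using Union by simp
  then obtain C U where CU: "\<And>n. closedin T (C n)" "\<And>n. openin T (U n)" "\<And>n. C n \<subseteq> E n"
      "\<And>n. E n \<subseteq> U n" "\<And>n. emeasure M (D \<inter> (U n - C n)) \<le> ennreal (\<epsilon>/2 * (1/2) ^ Suc n)"
    by metis
  have sets: "C n \<in> sets M" "U n \<in> sets M" for n
    using CU topological_measure_spaceD[OF tms] by auto
  have "fsigma_in T (\<Union>n. C n)"
    using CU(1) by (intro fsigma_in_Union) (auto intro: closed_imp_fsigma_in)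
  then obtain K where K: "closedin T K" "K \<subseteq> (\<Union>n. C n)"
      "emeasure M (D \<inter> ((\<Union>n. C n) - K)) < ennreal (\<epsilon>/2)"
    using fsigma_closed_inner_approx[OF tms D, of _ "ennreal (\<epsilon>/2)"] Union.prems by auto
  have KM: "K \<in> sets M"
    using K topological_measure_spaceD[OF tms] by auto
  have "emeasure M (D \<inter> ((\<Union>n. U n) - K))
      \<le> emeasure M ((\<Union>n. D \<inter> (U n - C n)) \<union> (D \<inter> ((\<Union>n. C n) - K)))"
    using sets D KM by (intro emeasure_mono) auto
  also have "\<dots> \<le> emeasure M (\<Union>n. D \<inter> (U n - C n)) + emeasure M (D \<inter> ((\<Union>n. C n) - K))"
    using sets D KM by (intro emeasure_subadditive) auto
  also have "\<dots> \<le> ennreal (\<epsilon>/2) + ennreal (\<epsilon>/2)"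
    using CU(5) sets D K(3) Union.prems by (intro add_mono emeasure_UN_geometric_le) auto
  also have "\<dots> = ennreal \<epsilon>"
    using Union.prems by (simp flip: ennreal_plus)
  finally have *: "emeasure M (D \<inter> ((\<Union>n. U n) - K)) \<le> ennreal \<epsilon>" .
  have "K \<subseteq> (\<Union>n. E n)"
    using CU(3) by (intro order_trans[OF K(2)] UN_mono) auto
  moreover have "(\<Union>n. E n) \<subseteq> (\<Union>n. U n)"
    using CU(4) by (intro UN_mono) auto
  moreover have "openin T (\<Union>n. U n)"
    using CU(2) by blast
  ultimately show ?case
    using * K(1) by (intro exI[of _ K] exI[of _ "\<Union>n. U n"]) simp
qed

text \<open>
  It matters that the sets \<open>D j\<close> of finite measure are open: the local approximations \<open>U j\<close> are only
  controlled inside \<open>D j\<close>, and \<open>D j \<inter> U j\<close> has to remain open.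
\<close>

lemma Borel_open_outer_approx:
  fixes \<epsilon> :: real and D :: "nat \<Rightarrow> 'a set"
  assumes tms: "topological_measure_space T M"
    and ofs: "\<And>U. openin T U \<Longrightarrow> \<exists>F Z. fsigma_in T F \<and> Z \<in> null_sets M \<and> U = F \<union> Z"
    and D: "\<And>j. openin T (D j)" "topspace T = (\<Union>j. D j)" "\<And>j. emeasure M (D j) < \<infinity>"
    and E: "E \<in> sets (Borel_of T)" and "0 < \<epsilon>"
  obtains U where "openin T U" "E \<subseteq> U" "emeasure M (U - E) \<le> ennreal \<epsilon>"
proof -
  note sets = topological_measure_spaceD[OF tms]
  have "\<exists>C U. closedin T C \<and> openin T U \<and> C \<subseteq> E \<and> E \<subseteq> U \<and>
      emeasure M (D j \<inter> (U - C)) \<le> ennreal (\<epsilon> * (1/2) ^ Suc j)" for j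
    using D \<open>0 < \<epsilon>\<close> sets by (intro Borel_squeeze_finite[OF tms ofs _ _ E]) auto
  then obtain C U where CU: "\<And>j. closedin T (C j)" "\<And>j. openin T (U j)" "\<And>j. C j \<subseteq> E"
      "\<And>j. E \<subseteq> U j" "\<And>j. emeasure M (D j \<inter> (U j - C j)) \<le> ennreal (\<epsilon> * (1/2) ^ Suc j)"
    by metis
  have "(\<Union>j. D j \<inter> U j) - E \<subseteq> (\<Union>j. D j \<inter> (U j - C j))"
    using CU(3) by blast
  then have "emeasure M ((\<Union>j. D j \<inter> U j) - E) \<le> emeasure M (\<Union>j. D j \<inter> (U j - C j))"
    using CU(1,2) D(1) sets(3,4) by (intro emeasure_mono sets.countable_UN) auto
  also have "\<dots> \<le> ennreal \<epsilon>"
    using CU D(1) sets \<open>0 < \<epsilon>\<close> by (intro emeasure_UN_geometric_le) auto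
  finally have *: "emeasure M ((\<Union>j. D j \<inter> U j) - E) \<le> ennreal \<epsilon>" .
  have "E \<subseteq> topspace T"
    using sets.sets_into_space[OF E] by simp
  then have "E \<subseteq> (\<Union>j. D j \<inter> U j)"
    unfolding D(2) UN_subset_iff using CU(4) by fastforce
  moreover have "openin T (\<Union>j. D j \<inter> U j)"
    using D(1) CU(2) by blast
  ultimately show thesis
    using that * by blast
qed

text \<open>
  Equality of measures only makes the excess null when the measure is finite, so the hull is
  assembled from hulls of the pieces \<open>E \<inter> D j\<close>.
\<close>

lemma Borel_hull_null_excess:
  fixes D :: "nat \<Rightarrow> 'a set"
  assumes tms: "topological_measure_space T M" and reg: "Borel_regular T M"
    and D: "\<And>j. D j \<in> sets M" "topspace T = (\<Union>j. D j)" "\<And>j. emeasure M (D j) < \<infinity>"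
    and E: "E \<in> sets M"
  obtains B where "B \<in> sets (Borel_of T)" "E \<subseteq> B" "emeasure M (B - E) = 0"
proof -
  note sets = topological_measure_spaceD[OF tms]
  have "\<exists>B\<in>sets (Borel_of T). E \<inter> D j \<subseteq> B \<and> emeasure M B = emeasure M (E \<inter> D j)" for j
    using reg E D(1)[of j] unfolding Borel_regular_def by auto
  then obtain B where B: "\<And>j. B j \<in> sets (Borel_of T)" "\<And>j. E \<inter> D j \<subseteq> B j"
      "\<And>j. emeasure M (B j) = emeasure M (E \<inter> D j)"
    by metis
  have "emeasure M (B j - E \<inter> D j) = 0" for j
  proof -
    have "emeasure M (E \<inter> D j) \<le> emeasure M (D j)"
      using D by (intro emeasure_mono) auto
    then have "emeasure M (E \<inter> D j) \<noteq> \<infinity>"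
      using D(3)[of j] by (auto simp: top_unique)
    then show ?thesis
      using emeasure_Diff[of M "E \<inter> D j" "B j"] E D(1) B sets by simp
  qed
  then have "(\<Union>j. B j - E \<inter> D j) \<in> null_sets M"
    using B E D(1) sets by (intro null_sets_UN) auto
  then have "(\<Union>j. B j) - E \<in> null_sets M"
    by (rule null_sets_subset) (use B E sets in auto)
  moreover have "E \<subseteq> (\<Union>j. B j)"
  proof
    fix x assume "x \<in> E"
    moreover have "x \<in> topspace T"
      using \<open>x \<in> E\<close> sets.sets_into_space[OF E] sets(1) by auto
    ultimately show "x \<in> (\<Union>j. B j)"
      using B(2) D(2) by auto
  qed
  moreover have "(\<Union>j. B j) \<in> sets (Borel_of T)"
    using B(1) by auto
  ultimately show thesis
    using that by auto
qed

text \<open>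
  Borel hulls give every measurable set an open outer approximation; applied to the complement, this
  yields the closed inner one.
\<close>

lemma measurable_squeeze:
  fixes \<epsilon> :: real and D :: "nat \<Rightarrow> 'a set"
  assumes tms: "topological_measure_space T M" and reg: "Borel_regular T M"
    and ofs: "\<And>U. openin T U \<Longrightarrow> \<exists>F Z. fsigma_in T F \<and> Z \<in> null_sets M \<and> U = F \<union> Z"
    and D: "\<And>j. openin T (D j)" "topspace T = (\<Union>j. D j)" "\<And>j. emeasure M (D j) < \<infinity>"
    and E: "E \<in> sets M" and "0 < \<epsilon>"
  obtains C U where "closedin T C" "openin T U" "C \<subseteq> E" "E \<subseteq> U" "emeasure M (U - C) \<le> ennreal \<epsilon>"
proof -
  note sets = topological_measure_spaceD[OF tms]
  have outer: "\<exists>U. openin T U \<and> A \<subseteq> U \<and> emeasure M (U - A) \<le> ennreal (\<epsilon>/2)"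
    if A: "A \<in> sets M" for A
  proof -
    obtain B where B: "B \<in> sets (Borel_of T)" "A \<subseteq> B" "emeasure M (B - A) = 0"
      using Borel_hull_null_excess[OF tms reg _ D(2,3) A] D(1) sets by metis
    obtain U where U: "openin T U" "B \<subseteq> U" "emeasure M (U - B) \<le> ennreal (\<epsilon>/2)"
      using Borel_open_outer_approx[OF tms ofs D B(1), of "\<epsilon>/2"] \<open>0 < \<epsilon>\<close> by auto
    have "U - A = (U - B) \<union> (B - A)"
      using U B by blast
    moreover have "emeasure M ((U - B) \<union> (B - A)) = emeasure M (U - B)"
      using U B A sets by (intro emeasure_Un_null_set) auto
    ultimately have "emeasure M (U - A) \<le> ennreal (\<epsilon>/2)"
      using U(3) by simp
    then show ?thesis
      using U(1,2) B(2) by blast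
  qed
  obtain U where U: "openin T U" "E \<subseteq> U" "emeasure M (U - E) \<le> ennreal (\<epsilon>/2)"
    using outer[OF E] by blast
  obtain V where V: "openin T V" "topspace T - E \<subseteq> V"
      "emeasure M (V - (topspace T - E)) \<le> ennreal (\<epsilon>/2)"
    using outer[of "topspace T - E"] E sets by (metis sets.compl_sets)
  let ?C = "topspace T - V"
  have "U - ?C \<subseteq> (U - E) \<union> (V - (topspace T - E))"
    using openin_subset[OF U(1)] by blast
  then have "emeasure M (U - ?C) \<le> emeasure M ((U - E) \<union> (V - (topspace T - E)))"
    using U V E sets by (intro emeasure_mono sets.Un sets.Diff) auto
  also have "\<dots> \<le> emeasure M (U - E) + emeasure M (V - (topspace T - E))"
    using U V E sets by (intro emeasure_subadditive sets.Diff) auto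
  also have "\<dots> \<le> ennreal (\<epsilon>/2) + ennreal (\<epsilon>/2)"
    using U V by (intro add_mono) auto
  also have "\<dots> = ennreal \<epsilon>"
    using \<open>0 < \<epsilon>\<close> by (simp flip: ennreal_plus)
  finally have "emeasure M (U - ?C) \<le> ennreal \<epsilon>" .
  moreover have "?C \<subseteq> E"
    using V(2) by blast
  ultimately show thesis
    using that[of ?C U] U V by blast
qed

section \<open>From Borel regularity to Lusin's theorem\<close>

text \<open>
  Only countably many preimages have to be made relatively open at once, those of a countable base,
  so the exceptional sets can be given measures that sum to \<open>\<epsilon>\<close>. Removing the whole gap \<open>U n - C n\<close>,
  and not just \<open>U n - E n\<close>, is what leaves a closed set behind.
\<close>

lemma Lusin_closed:
  fixes \<epsilon> :: real and D :: "nat \<Rightarrow> 'a set" and u :: "'a \<Rightarrow> 'b::second_countable_topology"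
  assumes tms: "topological_measure_space T M" and reg: "Borel_regular T M"
    and ofs: "\<And>U. openin T U \<Longrightarrow> \<exists>F Z. fsigma_in T F \<and> Z \<in> null_sets M \<and> U = F \<union> Z"
    and D: "\<And>j. openin T (D j)" "topspace T = (\<Union>j. D j)" "\<And>j. emeasure M (D j) < \<infinity>"
    and u: "u \<in> borel_measurable M" and "0 < \<epsilon>"
  obtains C where "closedin T C" "emeasure M (topspace T - C) \<le> ennreal \<epsilon>"
    "continuous_map (subtopology T C) euclidean u"
proof -
  note sets = topological_measure_spaceD[OF tms]
  obtain \<B> :: "'b set set" where \<B>: "countable \<B>" "topological_basis \<B>"
    using ex_countable_basis by blast
  then have "\<B> \<noteq> {}"
    using topological_basisE[of \<B> UNIV] by blast
  define W where "W = from_nat_into \<B>"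
  have W: "range W = \<B>"
    unfolding W_def using \<open>\<B> \<noteq> {}\<close> \<B>(1) by (rule range_from_nat_into)
  define E where "E n = u -` W n \<inter> topspace T" for n
  have "E n \<in> sets M" for n
  proof -
    have "open (W n)"
      using W topological_basis_open[OF \<B>(2)] by auto
    then show ?thesis
      using measurable_sets[OF u] sets(1) by (simp add: E_def)
  qed
  then have "\<exists>C U. closedin T C \<and> openin T U \<and> C \<subseteq> E n \<and> E n \<subseteq> U \<and>
      emeasure M (U - C) \<le> ennreal (\<epsilon> * (1/2) ^ Suc n)" for n
    using measurable_squeeze[OF tms reg ofs D, of "E n" "\<epsilon> * (1/2) ^ Suc n"] \<open>0 < \<epsilon>\<close>
    by (metis half_gt_zero_iff mult_pos_pos zero_less_power zero_less_one)
  then obtain C U where CU: "\<And>n. closedin T (C n)" "\<And>n. openin T (U n)" "\<And>n. C n \<subseteq> E n"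
      "\<And>n. E n \<subseteq> U n" "\<And>n. emeasure M (U n - C n) \<le> ennreal (\<epsilon> * (1/2) ^ Suc n)"
    by metis
  define K where "K = topspace T - (\<Union>n. U n - C n)"
  have op: "openin T (\<Union>n. U n - C n)"
    using CU by blast
  then have "closedin T K"
    unfolding K_def by (intro closedin_diff closedin_topspace)
  have "topspace T - K = (\<Union>n. U n - C n)"
    using openin_subset[OF op] unfolding K_def by blast
  then have "emeasure M (topspace T - K) \<le> ennreal \<epsilon>"
    using CU sets \<open>0 < \<epsilon>\<close> by (simp only:) (intro emeasure_UN_geometric_le, auto)
  moreover have "continuous_map (subtopology T K) euclidean u"
    unfolding continuous_map_def
  proof (intro conjI allI impI)
    fix V :: "'b set" assume "openin euclidean V"
    then have "open V"
      by simp
    \<comment> \<open>No point of \<open>K\<close> lies in a gap, so there \<open>C n\<close>, \<open>E n\<close> and \<open>U n\<close> cannot be told apart.\<close>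
    have on_K: "x \<in> U n \<longleftrightarrow> u x \<in> W n" if "x \<in> K" for x n
      using that CU(3)[of n] CU(4)[of n] unfolding K_def E_def by blast
    have "\<exists>n. x \<in> U n \<and> W n \<subseteq> V" if x: "x \<in> K" "u x \<in> V" for x
    proof -
      obtain A where "A \<in> \<B>" "u x \<in> A" "A \<subseteq> V"
        using topological_basisE[OF \<B>(2) \<open>open V\<close> x(2)] by blast
      then show ?thesis
        using W on_K[OF x(1)] by blast
    qed
    moreover have "u x \<in> V" if "x \<in> K" "x \<in> U n" "W n \<subseteq> V" for x n
      using that on_K by blast
    moreover have "topspace (subtopology T K) = K"
      by (auto simp: K_def)
    ultimately have "{x \<in> topspace (subtopology T K). u x \<in> V} = (\<Union>n\<in>{n. W n \<subseteq> V}. U n) \<inter> K"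
      by blast
    moreover have "openin T (\<Union>n\<in>{n. W n \<subseteq> V}. U n)"
      using CU(2) by blast
    ultimately show "openin (subtopology T K) {x \<in> topspace (subtopology T K). u x \<in> V}"
      by (auto simp: openin_subtopology)
  qed auto
  ultimately show thesis
    using that \<open>closedin T K\<close> by blast
qed

lemma weak_Lusin_if_Borel_regular:
  fixes D :: "nat \<Rightarrow> 'a set"
  assumes tms: "topological_measure_space T M" and reg: "Borel_regular T M"
    and ofs: "\<And>U. openin T U \<Longrightarrow> \<exists>F Z. fsigma_in T F \<and> Z \<in> null_sets M \<and> U = F \<union> Z"
    and D: "\<And>j. openin T (D j)" "topspace T = (\<Union>j. D j)" "\<And>j. emeasure M (D j) < \<infinity>"
  shows "weak_Lusin T M"
  unfolding weak_Lusin_def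
proof (intro allI impI, elim conjE)
  fix u :: "'a \<Rightarrow> ereal" and \<epsilon> :: real
  assume u: "u \<in> borel_measurable M" and "0 < \<epsilon>"
  then obtain C where C: "closedin T C" "emeasure M (topspace T - C) \<le> ennreal (\<epsilon>/2)"
      "continuous_map (subtopology T C) euclidean u"
    using Lusin_closed[OF tms reg ofs D u, of "\<epsilon>/2"] by auto
  moreover have "ennreal (\<epsilon>/2) < ennreal \<epsilon>"
    using \<open>0 < \<epsilon>\<close> by (intro ennreal_lessI) auto
  ultimately show "\<exists>C. closedin T C \<and> emeasure M (topspace T - C) < ennreal \<epsilon> \<and>
           continuous_map (subtopology T C) euclidean u"
    by (meson le_less_trans)
qed

lemma weak_Lusin_Borel_if_weak_Lusin:
  assumes "weak_Lusin T M"
  shows "weak_Lusin_Borel T M"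
  using assms closedin_Borel_of unfolding weak_Lusin_def weak_Lusin_Borel_def by meson

section \<open>From Lusin's theorem back to Borel regularity\<close>

lemma continuous_map_preimage_Borel:
  assumes "continuous_map (subtopology T B) euclidean u" "B \<in> sets (Borel_of T)" "open V"
  shows "u -` V \<inter> B \<in> sets (Borel_of T)"
proof -
  have B: "B \<subseteq> topspace T"
    using sets.sets_into_space[OF assms(2)] by simp
  have "openin (subtopology T B) {x \<in> topspace (subtopology T B). u x \<in> V}"
    using assms(1,3) by (simp add: continuous_map_def)
  then obtain G where "openin T G" "{x \<in> topspace (subtopology T B). u x \<in> V} = G \<inter> B"
    by (auto simp: openin_subtopology)
  moreover have "{x \<in> topspace (subtopology T B). u x \<in> V} = u -` V \<inter> B"
    using B by auto
  ultimately show ?thesis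
    using sets.Int[OF openin_Borel_of[OF \<open>openin T G\<close>] assms(2)] by simp
qed

text \<open>
  The restriction of \<open>u\<close> to each \<open>B n\<close> is Borel, being continuous, and countably many such
  restrictions glue to a Borel function on the union of the \<open>B n\<close>; the constant \<open>0\<close> fills the null
  Borel set that remains.
\<close>

lemma Borel_representatives_if_weak_Lusin_Borel:
  assumes tms: "topological_measure_space T M" and "weak_Lusin_Borel T M"
  shows "Borel_representatives T M"
  unfolding Borel_representatives_def
proof (intro allI impI)
  note sets = topological_measure_spaceD[OF tms]
  fix u :: "'a \<Rightarrow> ereal" assume "u \<in> borel_measurable M"
  then have "\<exists>B\<in>sets (Borel_of T). emeasure M (topspace T - B) < ennreal (1 / real (Suc n)) \<and>
      continuous_map (subtopology T B) euclidean u" for n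
    using assms(2) unfolding weak_Lusin_Borel_def by simp
  then obtain B where B: "\<And>n. B n \<in> sets (Borel_of T)"
      "\<And>n. emeasure M (topspace T - B n) < ennreal (1 / real (Suc n))"
      "\<And>n. continuous_map (subtopology T (B n)) euclidean u"
    by metis
  define N where "N = topspace T - (\<Union>n. B n)"
  have N: "N \<in> sets (Borel_of T)"
    unfolding N_def using B(1) by (metis sets.compl_sets sets.countable_UN space_Borel_of image_subsetI)
  have "emeasure M N \<le> ennreal (1 / real (Suc n))" for n
  proof -
    have "topspace T - B n \<in> sets M"
      using B(1) sets by (metis sets.compl_sets)
    then have "emeasure M N \<le> emeasure M (topspace T - B n)"
      by (intro emeasure_mono) (auto simp: N_def)
    then show ?thesis
      using B(2)[of n] by (meson less_imp_le order_trans)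
  qed
  moreover have "(\<lambda>n. ennreal (1 / real (Suc n))) \<longlonglongrightarrow> ennreal 0"
    by (intro tendsto_ennrealI LIMSEQ_Suc lim_1_over_n)
  ultimately have null: "emeasure M N = 0"
    using LIMSEQ_le_const[of "\<lambda>n. ennreal (1 / real (Suc n))" "ennreal 0" "emeasure M N"] by simp
  define f where "f x = (if x \<in> N then 0 else u x)" for x
  have "f \<in> borel_measurable (Borel_of T)"
  proof (rule borel_measurableI)
    fix V :: "ereal set" assume "open V"
    have BT: "B n \<subseteq> topspace T" for n
      using sets.sets_into_space[OF B(1)] by simp
    have preimage: "f -` V \<inter> space (Borel_of T) = (\<Union>n. u -` V \<inter> B n) \<union> (if 0 \<in> V then N else {})"
      using BT by (auto simp: f_def N_def split: if_splits)
    have "u -` V \<inter> B n \<in> sets (Borel_of T)" for n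
      using continuous_map_preimage_Borel[OF B(3) B(1) \<open>open V\<close>] .
    then have "(\<Union>n. u -` V \<inter> B n) \<in> sets (Borel_of T)"
      by (intro sets.countable_UN) blast
    moreover have "(if 0 \<in> V then N else {}) \<in> sets (Borel_of T)"
      using N by simp
    ultimately show "f -` V \<inter> space (Borel_of T) \<in> sets (Borel_of T)"
      unfolding preimage by (rule sets.Un)
  qed
  then show "\<exists>N\<in>sets (Borel_of T). \<exists>f :: 'a \<Rightarrow> ereal. f \<in> borel_measurable (Borel_of T) \<and>
      emeasure M N = 0 \<and> (\<forall>x\<in>topspace T - N. f x = u x)"
    using N null by (intro bexI[of _ N] exI[of _ f]) (auto simp: f_def)
qed

text \<open>
  If the indicator function of \<open>E\<close> agrees with a Borel function off the null Borel set \<open>N\<close>, then the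
  set where that function is \<open>1\<close> differs from \<open>E\<close> only inside \<open>N\<close>; adding \<open>N\<close> makes it a hull.
\<close>

lemma Borel_regular_if_Borel_representatives:
  assumes tms: "topological_measure_space T M" and "Borel_representatives T M"
  shows "Borel_regular T M"
  unfolding Borel_regular_def
proof
  note sets = topological_measure_spaceD[OF tms]
  fix E assume E: "E \<in> sets M"
  then have "(indicator E :: 'a \<Rightarrow> ereal) \<in> borel_measurable M"
    by measurable
  then obtain N and f :: "'a \<Rightarrow> ereal" where Nf: "N \<in> sets (Borel_of T)"
      "f \<in> borel_measurable (Borel_of T)" "emeasure M N = 0"
      "\<And>x. x \<in> topspace T - N \<Longrightarrow> f x = indicator E x"
    using assms(2) unfolding Borel_representatives_def by metis
  define B where "B = (f -` {1} \<inter> topspace T) \<union> N"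
  have B: "B \<in> sets (Borel_of T)"
    unfolding B_def using Nf(1) measurable_sets[OF Nf(2), of "{1}"] by auto
  have "E \<subseteq> topspace T"
    using sets.sets_into_space[OF E] sets(1) by simp
  then have "E \<subseteq> B"
    using Nf(4) by (auto simp: B_def)
  have "B \<subseteq> E \<union> N"
    using Nf(4) by (auto simp: B_def indicator_def split: if_splits)
  then have "emeasure M B \<le> emeasure M (E \<union> N)"
    using E Nf(1) sets by (intro emeasure_mono) auto
  also have "\<dots> = emeasure M E"
    using E Nf sets by (intro emeasure_Un_null_set) auto
  finally have "emeasure M B = emeasure M E"
    using emeasure_mono[OF \<open>E \<subseteq> B\<close>, of M] sets(2)[OF B] by (intro antisym) auto
  then show "\<exists>B\<in>sets (Borel_of T). E \<subseteq> B \<and> emeasure M B = emeasure M E"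
    using B \<open>E \<subseteq> B\<close> by blast
qed

section \<open>Normal spaces\<close>

text \<open>
  Extending \<open>tan\<close> by the values at infinity gives a monotone surjection onto a linear order, hence a
  continuous map; its inverse is continuous because the interval is compact.
\<close>

lemma ereal_embeds_compact_interval:
  obtains \<phi> :: "ereal \<Rightarrow> real" and \<psi> :: "real \<Rightarrow> ereal" and a b :: real
  where "continuous_on UNIV \<phi>" "continuous_on UNIV \<psi>" "range \<phi> \<subseteq> {a..b}" "a \<le> b" "\<And>y. \<psi> (\<phi> y) = y"
proof -
  define \<psi> :: "real \<Rightarrow> ereal" where
    "\<psi> x = (if x \<le> -(pi/2) then -\<infinity> else if pi/2 \<le> x then \<infinity> else ereal (tan x))" for x
  define \<phi> :: "ereal \<Rightarrow> real" where
    "\<phi> y = (if y = -\<infinity> then -(pi/2) else if y = \<infinity> then pi/2 else arctan (real_of_ereal y))" for y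
  have inv1: "\<psi> (\<phi> y) = y" for y
    using arctan_lbound[of "real_of_ereal y"] arctan_ubound[of "real_of_ereal y"] pi_gt_zero
    by (cases y) (auto simp: \<psi>_def \<phi>_def tan_arctan not_le simp del: pi_gt_zero)
  have inv2: "\<phi> (\<psi> x) = x" if "x \<in> {-(pi/2)..pi/2}" for x
    using that by (auto simp: \<psi>_def \<phi>_def arctan_tan)
  have range: "range \<phi> \<subseteq> {-(pi/2)..pi/2}"
    using arctan_lbound arctan_ubound pi_gt_zero by (auto simp: \<phi>_def less_imp_le)
  have surj: "\<psi> ` {-(pi/2)..pi/2} = UNIV"
    using inv1 range by (metis image_subset_iff rangeI surjI top.extremum_uniqueI
        subsetI UNIV_I image_eqI)
  have cont: "continuous_on UNIV \<psi>"
  proof (rule continuous_onI_mono)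
    show "open (range \<psi>)"
      using inv1 by (metis open_UNIV surjI)
    show "\<psi> x \<le> \<psi> y" if "x \<le> y" for x y
      using that by (auto simp: \<psi>_def tan_mono_le_eq)
  qed
  have "continuous_on (\<psi> ` {-(pi/2)..pi/2}) \<phi>"
    using inv2 by (intro continuous_on_inv continuous_on_subset[OF cont]) auto
  then have "continuous_on UNIV \<phi>"
    by (simp only: surj)
  moreover have "-(pi/2) \<le> pi/2"
    using pi_ge_zero by linarith
  ultimately show thesis
    using that cont range inv1 by blast
qed

text \<open>
  The extension of \<open>\<phi> \<circ> u\<close> is carried back to the extended reals by the continuous left inverse \<open>\<psi>\<close>
  of \<open>\<phi>\<close>.
\<close>

lemma Tietze_extension_ereal:
  fixes u :: "'a \<Rightarrow> ereal"
  assumes "normal_space T" "closedin T C" "continuous_map (subtopology T C) euclidean u"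
  obtains g where "continuous_map T euclidean g" "\<And>x. x \<in> C \<Longrightarrow> g x = u x"
proof -
  obtain \<phi> :: "ereal \<Rightarrow> real" and \<psi> a b where
    \<phi>: "continuous_on UNIV \<phi>" "continuous_on UNIV \<psi>" "range \<phi> \<subseteq> {a..b}" "a \<le> b" "\<And>y. \<psi> (\<phi> y) = y"
    using ereal_embeds_compact_interval by metis
  have "continuous_map (subtopology T C) euclideanreal (\<phi> \<circ> u)"
    using assms(3) \<phi>(1) by (intro continuous_map_compose[OF assms(3)]) auto
  moreover have "is_interval {a..b}" "{a..b} \<noteq> {}" "(\<phi> \<circ> u) ` C \<subseteq> {a..b}"
    using \<phi>(3,4) by (auto simp: is_interval_cc)
  ultimately obtain h where h: "continuous_map T euclideanreal h" "\<And>x. x \<in> C \<Longrightarrow> h x = (\<phi> \<circ> u) x"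
    using Tietze_extension_realinterval[OF assms(1,2)] by metis
  show thesis
  proof (rule that)
    show "continuous_map T euclidean (\<psi> \<circ> h)"
      using \<phi>(2) by (intro continuous_map_compose[OF h(1)]) auto
    show "(\<psi> \<circ> h) x = u x" if "x \<in> C" for x
      using h(2)[OF that] \<phi>(5) by simp
  qed
qed

lemma strong_Lusin_if_weak_Lusin:
  assumes "normal_space T" "weak_Lusin T M"
  shows "strong_Lusin T M"
  using assms Tietze_extension_ereal unfolding weak_Lusin_def strong_Lusin_def by metis

lemma strong_Lusin_Borel_if_strong_Lusin:
  assumes "strong_Lusin T M"
  shows "strong_Lusin_Borel T M"
  using assms closedin_Borel_of unfolding strong_Lusin_def strong_Lusin_Borel_def by meson

lemma weak_Lusin_Borel_if_strong_Lusin_Borel: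
  assumes "strong_Lusin_Borel T M"
  shows "weak_Lusin_Borel T M"
  unfolding weak_Lusin_Borel_def
proof (intro allI impI)
  fix u :: "'a \<Rightarrow> ereal" and \<epsilon> :: real
  assume "u \<in> borel_measurable M \<and> 0 < \<epsilon>"
  then obtain B and g :: "'a \<Rightarrow> ereal" where B: "B \<in> sets (Borel_of T)" "continuous_map T euclidean g"
      "emeasure M (topspace T - B) < ennreal \<epsilon>" "\<And>x. x \<in> B \<Longrightarrow> g x = u x"
    using assms unfolding strong_Lusin_Borel_def by metis
  have "continuous_map (subtopology T B) euclidean u"
    using continuous_map_from_subtopology[OF B(2)] by (rule continuous_map_eq) (use B(4) in auto)
  then show "\<exists>B\<in>sets (Borel_of T). emeasure M (topspace T - B) < ennreal \<epsilon> \<and>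
           continuous_map (subtopology T B) euclidean u"
    using B by blast
qed

section \<open>The equivalences\<close>

theorem theorem6p1:
  fixes T :: "'a topology" and M :: "'a measure"
  assumes "topological_measure_space T M"
    and "\<exists>O' :: nat \<Rightarrow> 'a set. (\<forall>j. openin T (O' j)) \<and> topspace T = (\<Union>j. O' j) \<and>
           (\<forall>j. emeasure M (O' j) < \<infinity>)"
    and "\<forall>U. openin T U \<longrightarrow> (\<exists>F Z. fsigma_in T F \<and> Z \<in> null_sets M \<and> U = F \<union> Z)"
  shows "(Borel_regular T M \<longleftrightarrow> Borel_representatives T M) \<and>
         (Borel_regular T M \<longleftrightarrow> weak_Lusin T M) \<and>
         (Borel_regular T M \<longleftrightarrow> weak_Lusin_Borel T M) \<and>
         (normal_space T \<longrightarrow>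
            (Borel_regular T M \<longleftrightarrow> strong_Lusin T M) \<and>
            (Borel_regular T M \<longleftrightarrow> strong_Lusin_Borel T M))"
proof -
  obtain D :: "nat \<Rightarrow> 'a set" where D: "\<And>j. openin T (D j)" "topspace T = (\<Union>j. D j)"
      "\<And>j. emeasure M (D j) < \<infinity>"
    using assms(2) by blast
  have "Borel_regular T M \<Longrightarrow> weak_Lusin T M"
    using weak_Lusin_if_Borel_regular[OF assms(1) _ _ D] assms(3) by blast
  moreover have "weak_Lusin T M \<Longrightarrow> weak_Lusin_Borel T M"
    by (rule weak_Lusin_Borel_if_weak_Lusin)
  moreover have "weak_Lusin_Borel T M \<Longrightarrow> Borel_representatives T M"
    by (rule Borel_representatives_if_weak_Lusin_Borel[OF assms(1)])
  moreover have "Borel_representatives T M \<Longrightarrow> Borel_regular T M"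
    by (rule Borel_regular_if_Borel_representatives[OF assms(1)])
  moreover have "normal_space T \<Longrightarrow> weak_Lusin T M \<Longrightarrow> strong_Lusin T M"
    by (rule strong_Lusin_if_weak_Lusin)
  moreover have "strong_Lusin T M \<Longrightarrow> strong_Lusin_Borel T M"
    by (rule strong_Lusin_Borel_if_strong_Lusin)
  moreover have "strong_Lusin_Borel T M \<Longrightarrow> weak_Lusin_Borel T M"
    by (rule weak_Lusin_Borel_if_strong_Lusin_Borel)
  ultimately show ?thesis
    by blast
qed

end
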